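(* (Marsden identity.) Let $a,b\in\mathbb R$ with $d(a-jh,b-ih)\neq0$ for $0\le i\le j\le n-1$. Then for all $t,x\in\mathbb R$ $$(d(t,x))_h^n=\sum_{k=0}^n\left\{\prod_{j=0}^{k-1}d(b-jh,x)\prod_{j=k}^{n-1}d(a-jh,x)\right\}B_k^n(t,[a,b];\gamma,h),$$ where $(d(t,x))_h^n=\prod_{j=0}^{n-1}d(t-jh,x)$.
   Context: Let $n\ge 1$ be an integer and $h\in\mathbb R$ fixed. Let $\gamma_1,\gamma_2:\mathbb R\to\mathbb R$ be continuous, linearly independent functions. They are assumed translation invariant: for every $s\in\mathbb R$ there is an invertible $2\times2$ matrix $C(s)$ with $\begin{pmatrix}\gamma_1(x-s)\\ \gamma_2(x-s)\end{pmatrix}=C(s)\begin{pmatrix}\gamma_1(x)\\ \gamma_2(x)\end{pmatrix}$ for all $x$. Put $d(u,v)=\gamma_1(u)\gamma_2(v)-\gamma_2(u)\gamma_1(v)$. For $0\le k\le n$ put $G_{n,k}(t;h)=\sum_{I\subseteq\{1,\ldots,n\},\,|I|=k}\ \prod_{i\in I}\gamma_1(t-(i-1)h)\prod_{i\in\{1,\ldots,n\}\setminus I}\gamma_2(t-(i-1)h)$. Standing assumption: $h$ is such that the functions $t\mapsto G_{n,k}(t;h)$, $k=0,\ldots,n$, are linearly independent. $h$--$\gamma$ Bernstein basis functions: $[a,b]$ denotes the interval determined by the endpoints $a,b$ in either order. Take arbitrary initial values $P_0^0,\ldots,P_n^0$ and define $$P_i^{k+1}(x)=\frac{d(x-kh,b-ih)}{d(a-(i+k)h,b-ih)}P_i^k(x)+\frac{d(a-(i+k)h,x-kh)}{d(a-(i+k)h,b-ih)}P_{i+1}^k(x),\quad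 0\le i\le n-k-1,\ 0\le k\le n-1.$$ $B_k^n(x,[a,b];\gamma,h)$ is by definition the coefficient of $P_k^0$ in $P_0^n(x)$: $P_0^n(x)=\sum_{k=0}^nP_k^0\,B_k^n(x,[a,b];\gamma,h)$. *)

theory Defs
  imports "HOL-Analysis.Analysis"
begin

text \<open>Linear independence of a finite indexed family of real functions; being about the family
  and not its image, it fails as soon as two members coincide.\<close>

definition lin_indep_family :: "'i set \<Rightarrow> ('i \<Rightarrow> real \<Rightarrow> real) \<Rightarrow> bool" where
  "lin_indep_family K f \<longleftrightarrow>
     (\<forall>c. (\<forall>t. (\<Sum>k\<in>K. c k * f k t) = 0) \<longrightarrow> (\<forall>k\<in>K. c k = 0))"

definition translation_invariant :: "(real \<Rightarrow> real) \<Rightarrow> (real \<Rightarrow> real) \<Rightarrow> bool" where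
  "translation_invariant \<gamma>1 \<gamma>2 \<longleftrightarrow>
     (\<forall>s. \<exists>C :: real^2^2. invertible C \<and>
        (\<forall>x. (vector [\<gamma>1 (x - s), \<gamma>2 (x - s)] :: real^2) = C *v vector [\<gamma>1 x, \<gamma>2 x]))"

definition d :: "(real \<Rightarrow> real) \<Rightarrow> (real \<Rightarrow> real) \<Rightarrow> real \<Rightarrow> real \<Rightarrow> real" where
  "d \<gamma>1 \<gamma>2 u v = \<gamma>1 u * \<gamma>2 v - \<gamma>2 u * \<gamma>1 v"

definition G :: "(real \<Rightarrow> real) \<Rightarrow> (real \<Rightarrow> real) \<Rightarrow> real \<Rightarrow> nat \<Rightarrow> nat \<Rightarrow> real \<Rightarrow> real" where
  "G \<gamma>1 \<gamma>2 h n k t =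
     (\<Sum>I | I \<subseteq> {1..n} \<and> card I = k.
        (\<Prod>i\<in>I. \<gamma>1 (t - (real i - 1) * h)) * (\<Prod>i\<in>{1..n} - I. \<gamma>2 (t - (real i - 1) * h)))"

definition d_power ::
  "(real \<Rightarrow> real) \<Rightarrow> (real \<Rightarrow> real) \<Rightarrow> real \<Rightarrow> nat \<Rightarrow> real \<Rightarrow> real \<Rightarrow> real" where
  "d_power \<gamma>1 \<gamma>2 h n t x = (\<Prod>j<n. d \<gamma>1 \<gamma>2 (t - real j * h) x)"

text \<open>\<open>recP \<gamma>1 \<gamma>2 h a b p k i x\<close> is $P_i^k(x)$ for the initial values $P_i^0$ = \<open>p i\<close>.
  The recurrence does not mention $n$; $P_0^n(x)$ uses only the entries with $i + k \le n$,
  in particular only \<open>p 0\<close>, ..., \<open>p n\<close>.\<close>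

primrec recP ::
  "(real \<Rightarrow> real) \<Rightarrow> (real \<Rightarrow> real) \<Rightarrow> real \<Rightarrow> real \<Rightarrow> real \<Rightarrow> (nat \<Rightarrow> real) \<Rightarrow> nat \<Rightarrow> nat \<Rightarrow> real \<Rightarrow> real"
where
  "recP \<gamma>1 \<gamma>2 h a b p 0 i x = p i"
| "recP \<gamma>1 \<gamma>2 h a b p (Suc k) i x =
     d \<gamma>1 \<gamma>2 (x - real k * h) (b - real i * h) / d \<gamma>1 \<gamma>2 (a - real (i + k) * h) (b - real i * h)
       * recP \<gamma>1 \<gamma>2 h a b p k i x
   + d \<gamma>1 \<gamma>2 (a - real (i + k) * h) (x - real k * h) / d \<gamma>1 \<gamma>2 (a - real (i + k) * h) (b - real i * h)
       * recP \<gamma>1 \<gamma>2 h a b p k (Suc i) x"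

text \<open>The coefficient of $P_k^0$ in $P_0^n(x)$, viewed as a linear form in the initial values.
  Existence and uniqueness for $k \le n$ are established below.\<close>

definition bernstein ::
  "(real \<Rightarrow> real) \<Rightarrow> (real \<Rightarrow> real) \<Rightarrow> real \<Rightarrow> real \<Rightarrow> real \<Rightarrow> nat \<Rightarrow> nat \<Rightarrow> real \<Rightarrow> real" where
  "bernstein \<gamma>1 \<gamma>2 h a b n k x =
     (THE c. \<exists>\<beta>. (\<forall>p. recP \<gamma>1 \<gamma>2 h a b p n 0 x = (\<Sum>j\<le>n. p j * \<beta> j)) \<and> \<beta> k = c)"

lemma recP_linear:
  "\<exists>\<beta>. \<forall>p. recP \<gamma>1 \<gamma>2 h a b p k i x = (\<Sum>j\<le>k. p (i + j) * \<beta> j)"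
proof (induction k arbitrary: i)
  case 0
  show ?case by (intro exI[of _ "\<lambda>_. 1"]) simp
next
  case (Suc k)
  obtain \<beta> where \<beta>: "\<And>p. recP \<gamma>1 \<gamma>2 h a b p k i x = (\<Sum>j\<le>k. p (i + j) * \<beta> j)"
    using Suc by blast
  obtain \<beta>' where \<beta>': "\<And>p. recP \<gamma>1 \<gamma>2 h a b p k (Suc i) x = (\<Sum>j\<le>k. p (Suc i + j) * \<beta>' j)"
    using Suc by blast
  define A where
    "A = d \<gamma>1 \<gamma>2 (x - real k * h) (b - real i * h) / d \<gamma>1 \<gamma>2 (a - real (i + k) * h) (b - real i * h)"
  define B where
    "B = d \<gamma>1 \<gamma>2 (a - real (i + k) * h) (x - real k * h) / d \<gamma>1 \<gamma>2 (a - real (i + k) * h) (b - real i * h)"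
  define \<delta> where
    "\<delta> j = A * (if j \<le> k then \<beta> j else 0) + B * (case j of 0 \<Rightarrow> 0 | Suc m \<Rightarrow> \<beta>' m)" for j
  have "recP \<gamma>1 \<gamma>2 h a b p (Suc k) i x = (\<Sum>j\<le>Suc k. p (i + j) * \<delta> j)" for p
  proof -
    have 1: "(\<Sum>j\<le>Suc k. p (i + j) * (if j \<le> k then \<beta> j else 0)) = (\<Sum>j\<le>k. p (i + j) * \<beta> j)"
      by simp
    have 2: "(\<Sum>j\<le>Suc k. p (i + j) * (case j of 0 \<Rightarrow> 0 | Suc m \<Rightarrow> \<beta>' m))
        = (\<Sum>j\<le>k. p (Suc i + j) * \<beta>' j)"
      by (subst sum.atMost_Suc_shift) simp
    have "(\<Sum>j\<le>Suc k. p (i + j) * \<delta> j)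
        = A * (\<Sum>j\<le>Suc k. p (i + j) * (if j \<le> k then \<beta> j else 0))
        + B * (\<Sum>j\<le>Suc k. p (i + j) * (case j of 0 \<Rightarrow> 0 | Suc m \<Rightarrow> \<beta>' m))"
      unfolding \<delta>_def sum_distrib_left sum.distrib[symmetric]
      by (intro sum.cong) (auto simp: algebra_simps)
    then show ?thesis
      unfolding 1 2 by (simp only: recP.simps \<beta> \<beta>' A_def B_def)
  qed
  then show ?case by blast
qed

lemma bernstein_unique:
  assumes \<beta>: "\<And>p. recP \<gamma>1 \<gamma>2 h a b p n 0 x = (\<Sum>j\<le>n. p j * \<beta> j)" and "k \<le> n"
  shows "bernstein \<gamma>1 \<gamma>2 h a b n k x = \<beta> k"
  unfolding bernstein_def
proof (rule the_equality)
  show "\<exists>\<beta>'. (\<forall>p. recP \<gamma>1 \<gamma>2 h a b p n 0 x = (\<Sum>j\<le>n. p j * \<beta>' j)) \<and> \<beta>' k = \<beta> k"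
    using \<beta> by blast
next
  fix c
  assume "\<exists>\<beta>'. (\<forall>p. recP \<gamma>1 \<gamma>2 h a b p n 0 x = (\<Sum>j\<le>n. p j * \<beta>' j)) \<and> \<beta>' k = c"
  then obtain \<beta>' where \<beta>': "\<And>p. recP \<gamma>1 \<gamma>2 h a b p n 0 x = (\<Sum>j\<le>n. p j * \<beta>' j)" "\<beta>' k = c"
    by blast
  have e: "(\<Sum>j\<le>n. (if j = k then 1 else 0) * f j) = f k" for f :: "nat \<Rightarrow> real"
    using \<open>k \<le> n\<close> by (simp add: if_distrib[of "\<lambda>y. y * _"] cong: if_cong)
  show "c = \<beta> k"
    using \<beta>[of "\<lambda>j. if j = k then 1 else 0"] \<beta>'(1)[of "\<lambda>j. if j = k then 1 else 0"] \<beta>'(2)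
    by (simp only: e)
qed

lemma recP_bernstein:
  "recP \<gamma>1 \<gamma>2 h a b p n 0 x = (\<Sum>k\<le>n. p k * bernstein \<gamma>1 \<gamma>2 h a b n k x)"
proof -
  obtain \<beta> where \<beta>: "\<And>p. recP \<gamma>1 \<gamma>2 h a b p n 0 x = (\<Sum>j\<le>n. p j * \<beta> j)"
    using recP_linear[of \<gamma>1 \<gamma>2 h a b n 0 x] by (auto simp only: add_0)
  show ?thesis
    using \<beta>[of p] bernstein_unique[OF \<beta>] by simp
qed

end

theory Submission
  imports Defs
begin

text \<open>Take the coefficients of the Bernstein basis as initial values of the recurrence. By
  Pluecker's identity \<open>d(u,v) d(w,x) + d(w,u) d(v,x) = d(w,v) d(u,x)\<close>, each step trades the factors
  of the initial values coming from \<open>a\<close> and \<open>b\<close> for one factor \<open>d(t - kh, x)\<close>, so after \<open>n\<close> steps only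
  these factors remain.\<close>

lemma d_pluecker:
  "d \<gamma>1 \<gamma>2 u v * d \<gamma>1 \<gamma>2 w x + d \<gamma>1 \<gamma>2 w u * d \<gamma>1 \<gamma>2 v x = d \<gamma>1 \<gamma>2 w v * d \<gamma>1 \<gamma>2 u x"
  unfolding d_def by algebra

text \<open>Induction on \<open>k\<close>: at stage \<open>k\<close>, entry \<open>i\<close> has
  exchanged the \<open>a\<close>-factors of \<open>p i\<close> with indices \<open>i\<close>, ...,
  \<open>i + k - 1\<close> for the \<open>k\<close> factors of \<open>d_power\<close>. Arbitrary
  \<open>i\<close> is needed because a step combines two neighbouring entries.\<close>

lemma recP_marsden:
  fixes n :: nat and h a b t x :: real and \<gamma>1 \<gamma>2 :: "real \<Rightarrow> real"
  assumes nz: "\<And>i j. i \<le> j \<Longrightarrow> j < n \<Longrightarrow> d \<gamma>1 \<gamma>2 (a - real j * h) (b - real i * h) \<noteq> 0"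
    and "i + k \<le> n"
  defines "p \<equiv> \<lambda>k. (\<Prod>j<k. d \<gamma>1 \<gamma>2 (b - real j * h) x) * (\<Prod>j = k..<n. d \<gamma>1 \<gamma>2 (a - real j * h) x)"
  shows "recP \<gamma>1 \<gamma>2 h a b p k i t =
    d_power \<gamma>1 \<gamma>2 h k t x
      * ((\<Prod>j<i. d \<gamma>1 \<gamma>2 (b - real j * h) x) * (\<Prod>j = i + k..<n. d \<gamma>1 \<gamma>2 (a - real j * h) x))"
  using \<open>i + k \<le> n\<close>
proof (induction k arbitrary: i)
  case 0
  show ?case by (simp add: p_def d_power_def)
next
  case (Suc k)
  let ?A = "a - real (i + k) * h" and ?B = "b - real i * h" and ?T = "t - real k * h"
  define D where "D = d \<gamma>1 \<gamma>2"
  define Q where "Q = d_power \<gamma>1 \<gamma>2 h k t x"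
  define R where "R = (\<Prod>j<i. d \<gamma>1 \<gamma>2 (b - real j * h) x)"
  define S where "S = (\<Prod>j = Suc (i + k)..<n. d \<gamma>1 \<gamma>2 (a - real j * h) x)"
  \<comment> \<open>The two neighbours share \<open>Q * R * S\<close>. They differ in one factor:
    the lowest remaining \<open>a\<close>-factor here, the newest \<open>b\<close>-factor in
    \<open>right\<close>.\<close>
  have left: "recP \<gamma>1 \<gamma>2 h a b p k i t = Q * (R * (D ?A x * S))"
    using Suc.IH[of i] Suc.prems
    by (simp add: prod.atLeast_Suc_lessThan D_def Q_def R_def S_def)
  have right: "recP \<gamma>1 \<gamma>2 h a b p k (Suc i) t = Q * (R * D ?B x * S)"
    using Suc.IH[of "Suc i"] Suc.prems by (simp add: D_def Q_def R_def S_def)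
  have "D ?A ?B \<noteq> 0"
    using nz[of i "i + k"] Suc.prems by (simp add: D_def)
  have "recP \<gamma>1 \<gamma>2 h a b p (Suc k) i t =
      (D ?T ?B * D ?A x + D ?A ?T * D ?B x) / D ?A ?B * (Q * R * S)"
    by (simp only: recP.simps left right flip: D_def) (simp add: add_divide_distrib distrib_left mult_ac)
  \<comment> \<open>Pluecker with \<open>u = ?T\<close>, \<open>v = ?B\<close>,
    \<open>w = ?A\<close> turns the numerator into \<open>D ?A ?B * D ?T x\<close>, cancelling the
    denominator.\<close>
  also have "\<dots> = D ?T x * (Q * R * S)"
    using \<open>D ?A ?B \<noteq> 0\<close> by (simp add: D_def d_pluecker)
  also have "\<dots> = d_power \<gamma>1 \<gamma>2 h (Suc k) t x * (R * S)"
    by (simp add: d_power_def D_def Q_def)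
  finally show ?case
    by (simp add: R_def S_def)
qed

theorem theorem5p12:
  fixes n :: nat and h a b t x :: real and \<gamma>1 \<gamma>2 :: "real \<Rightarrow> real"
  assumes "n \<ge> 1"
    and "continuous_on UNIV \<gamma>1" and "continuous_on UNIV \<gamma>2"
    and "lin_indep_family {..<2} (\<lambda>i. [\<gamma>1, \<gamma>2] ! i)"
    and "translation_invariant \<gamma>1 \<gamma>2"
    and "lin_indep_family {0..n} (G \<gamma>1 \<gamma>2 h n)"
    and "\<And>i j. i \<le> j \<Longrightarrow> j \<le> n - 1 \<Longrightarrow> d \<gamma>1 \<gamma>2 (a - real j * h) (b - real i * h) \<noteq> 0"
  shows "d_power \<gamma>1 \<gamma>2 h n t x =
    (\<Sum>k = 0..n. ((\<Prod>j<k. d \<gamma>1 \<gamma>2 (b - real j * h) x) * (\<Prod>j = k..<n. d \<gamma>1 \<gamma>2 (a - real j * h) x))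
       * bernstein \<gamma>1 \<gamma>2 h a b n k t)"
proof -
  define p where "p = (\<lambda>k. (\<Prod>j<k. d \<gamma>1 \<gamma>2 (b - real j * h) x)
    * (\<Prod>j = k..<n. d \<gamma>1 \<gamma>2 (a - real j * h) x))"
  \<comment> \<open>For \<open>i = 0\<close> and \<open>k = n\<close> both remaining products are
    empty.\<close>
  have "recP \<gamma>1 \<gamma>2 h a b p n 0 t = d_power \<gamma>1 \<gamma>2 h n t x"
    using recP_marsden[of n \<gamma>1 \<gamma>2 a h b 0 n x t] assms(7) by (simp add: p_def)
  \<comment> \<open>Expanding the same entry as a linear form in \<open>p\<close> gives the
    Bernstein sum.\<close>
  then show ?thesis
    by (simp add: recP_bernstein p_def atMost_atLeast0)
qed

end
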